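(* Assume: (A1) $\sum_{i=1}^{\infty} w_i = \infty$ and $\sum_{i=1}^{\infty} w_i^2 < \infty$; (A2) the map $G\mapsto\int_\Theta p(x|\theta)\,G(d\theta)$, from probability measures on $\Theta$ to mixture densities on $\mathcal{X}$, is injective; (A3) for each $x\in\mathcal{X}$, the map $\theta\mapsto p(x|\theta)$ is bounded and continuous on $\Theta$; (A4) for any $\varepsilon>0$ and any compact $\mathcal{X}_0\subset\mathcal{X}$, there exists a compact $\Theta_0\subset\Theta$ such that $\int_{\mathcal{X}_0}p(x|\theta)\,\nu(dx)<\varepsilon$ for all $\theta\notin\Theta_0$; (A5) there exists a constant $B<\infty$ such that, for every $\theta_1,\theta_2,\theta_3\in\Theta$, $$\int_{\mathcal{X}} \left(\frac{p(x|\theta_1)}{p(x|\theta_2)}\right)^2 p(x|\theta_3)\,\nu(dx) < B.$$ Let $d$ be a divergence measure between probability densities that is convex in its second argument (the estimate). Then, for every $n\ge 1$, $$\mathbb{E}\,d(f,\bar f_n)\le \mathbb{E}\,d(f,f_n)\qquad\text{and}\qquad \mathbb{E}\,d(p,\bar p_n)\le\mathbb{E}\,d(p,p_n),$$ where in the first inequality $d$ is a divergence between densities on $\Theta$ with respect to $\mu$ and in the second a divergence between densities on $\mathcal{X}$ with respect to $\nu$. In particular, these inequalities hold when $d$ is the Kullback–Leibler divergence $d(g,h)=\int g\log(g/h)$ and when $d$ is the $L_1$ distance $d(g,h)=\int|g-h|$.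
   Context: Setting. $\mathcal{X}$ and $\Theta$ are Polish spaces with their Borel $\sigma$-algebras, and $\nu$, $\mu$ are $\sigma$-finite measures on $\mathcal{X}$ and $\Theta$, respectively. The function $(x,\theta)\mapsto p(x|\theta)\ge 0$ is jointly measurable and, for each $\theta\in\Theta$, $p(\cdot|\theta)$ is a probability density on $\mathcal{X}$ with respect to $\nu$. $F$ is a probability measure on $\Theta$, absolutely continuous with respect to $\mu$, with density $f=dF/d\mu$. $X_1,X_2,\ldots$ are i.i.d. with density (with respect to $\nu$) $$p(x)=\int_\Theta p(x|\theta)f(\theta)\,\mu(d\theta).$$ Recursive estimate. Fix a probability density $f_0$ on $\Theta$ with respect to $\mu$ and a deterministic sequence of weights $w_1,w_2,\ldots\in(0,1)$. Given an ordered sample $x_1,\ldots,x_n\in\mathcal{X}$, define recursively, for $i=1,\ldots,n$, $$f_i(\theta)=(1-w_i)f_{i-1}(\theta)+w_i\,\frac{p(x_i|\theta)f_{i-1}(\theta)}{\int_\Theta p(x_i|\theta')f_{i-1}(\theta')\,\mu(d\theta')},\qquad \theta\in\Theta.$$ Let $f_n$ be the final estimate obtained from the data in the order $X_1,\ldots,X_n$, and $p_n(x)=\int_\Theta p(x|\theta)f_n(\theta)\,\mu(d\theta)$. Permutation-averaged estimate. Let $S_n$ be the permutation group on $\{1,\ldots,n\}$. For $s\in S_n$, let $f_{n,s}$ be the final estimate produced by the recursion (same $f_0$, same weights $w_1,\ldots,w_n$) applied to the data in the order $X_{s(1)},\ldots,X_{s(n)}$. Define $$\bar f_n=\frac{1}{n!}\sum_{s\in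 S_n}f_{n,s},\qquad \bar p_n(x)=\int_\Theta p(x|\theta)\bar f_n(\theta)\,\mu(d\theta).$$ Conventions. A divergence measure takes values in $[0,\infty]$ and is such that the quantities whose expectations are taken are measurable; expectations may equal $+\infty$. In (A2), mixture densities are identified when equal $\nu$-almost everywhere. In (A5), $a/0=\infty$ for $a>0$, $0/0=0$, and $0\cdot\infty=0$. *)

theory Defs
  imports "HOL-Probability.Probability" "HOL-Combinatorics.Permutations"
begin

definition prob_density :: "'a measure \<Rightarrow> ('a \<Rightarrow> real) \<Rightarrow> bool" where
  "prob_density M g \<longleftrightarrow>
     g \<in> borel_measurable M \<and> (\<forall>x\<in>space M. 0 \<le> g x) \<and> (\<integral>\<^sup>+x. ennreal (g x) \<partial>M) = 1"

definition mixture :: "'b measure \<Rightarrow> ('a \<Rightarrow> 'b \<Rightarrow> real) \<Rightarrow> ('b \<Rightarrow> real) \<Rightarrow> 'a \<Rightarrow> real" where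
  "mixture \<mu> k g x = (\<integral>\<theta>. k x \<theta> * g \<theta> \<partial>\<mu>)"

text \<open>The kernel \<open>k x \<theta>\<close> is \<open>p(x|\<theta>)\<close>. Samples and weights are sequences whose entries at
  \<open>1, \<dots>, n\<close> are used; index \<open>0\<close> is ignored. A vanishing normalising constant makes the
  quotient \<open>0\<close>.\<close>

primrec recursive_estimate ::
  "'b measure \<Rightarrow> ('a \<Rightarrow> 'b \<Rightarrow> real) \<Rightarrow> ('b \<Rightarrow> real) \<Rightarrow> (nat \<Rightarrow> real) \<Rightarrow> (nat \<Rightarrow> 'a) \<Rightarrow> nat \<Rightarrow> 'b \<Rightarrow> real"
where
  "recursive_estimate \<mu> k f0 w x 0 = f0"
| "recursive_estimate \<mu> k f0 w x (Suc i) = (\<lambda>\<theta>.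
     (1 - w (Suc i)) * recursive_estimate \<mu> k f0 w x i \<theta> +
     w (Suc i) * (k (x (Suc i)) \<theta> * recursive_estimate \<mu> k f0 w x i \<theta> /
       (\<integral>\<theta>'. k (x (Suc i)) \<theta>' * recursive_estimate \<mu> k f0 w x i \<theta>' \<partial>\<mu>)))"

definition averaged_estimate ::
  "'b measure \<Rightarrow> ('a \<Rightarrow> 'b \<Rightarrow> real) \<Rightarrow> ('b \<Rightarrow> real) \<Rightarrow> (nat \<Rightarrow> real) \<Rightarrow> (nat \<Rightarrow> 'a) \<Rightarrow> nat \<Rightarrow> 'b \<Rightarrow> real"
where
  "averaged_estimate \<mu> k f0 w x n = (\<lambda>\<theta>.
     1 / fact n * (\<Sum>s | s permutes {1..n}. recursive_estimate \<mu> k f0 w (\<lambda>i. x (s i)) n \<theta>))"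

definition convex_in_second :: "'a measure \<Rightarrow> (('a \<Rightarrow> real) \<Rightarrow> ('a \<Rightarrow> real) \<Rightarrow> ennreal) \<Rightarrow> bool" where
  "convex_in_second M d \<longleftrightarrow>
     (\<forall>g h1 h2 t. prob_density M g \<and> prob_density M h1 \<and> prob_density M h2 \<and> 0 \<le> t \<and> t \<le> 1 \<longrightarrow>
        d g (\<lambda>x. (1 - t) * h1 x + t * h2 x) \<le> ennreal (1 - t) * d g h1 + ennreal t * d g h2)"

text \<open>The integrand \<open>a log (a / b)\<close> of the Kullback--Leibler divergence, with the conventions
  \<open>0 log (0 / b) = 0\<close> and \<open>a log (a / 0) = \<infinity>\<close> for \<open>a > 0\<close>.\<close>

definition kl_integrand :: "real \<Rightarrow> real \<Rightarrow> ereal" where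
  "kl_integrand a b = (if a = 0 then 0 else if b = 0 then \<infinity> else ereal (a * ln (a / b)))"

text \<open>The integral is the integral of the positive part minus that of the negative part. For
  probability densities the latter is finite (as \<open>a log (a / b) \<ge> a - b\<close>) and not larger than the
  former, so that the truncated subtraction on \<^typ>\<open>ennreal\<close> is exact.
  The real-valued library constant \<^const>\<open>KL_divergence\<close> cannot take the value \<open>\<infinity>\<close>.\<close>

definition kl_div :: "'a measure \<Rightarrow> ('a \<Rightarrow> real) \<Rightarrow> ('a \<Rightarrow> real) \<Rightarrow> ennreal" where
  "kl_div M g h =
     (\<integral>\<^sup>+x. e2ennreal (kl_integrand (g x) (h x)) \<partial>M) -
     (\<integral>\<^sup>+x. e2ennreal (- kl_integrand (g x) (h x)) \<partial>M)"

definition l1_dist :: "'a measure \<Rightarrow> ('a \<Rightarrow> real) \<Rightarrow> ('a \<Rightarrow> real) \<Rightarrow> ennreal" where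
  "l1_dist M g h = (\<integral>\<^sup>+x. ennreal \<bar>g x - h x\<bar> \<partial>M)"

end

theory Submission
  imports Defs
begin

text \<open>
  The estimate \<open>f\<^sub>n\<close> depends on the order of the data, but the law of the data does not: for every
  permutation \<open>s\<close> the vectors \<open>(X\<^sub>s\<^sub>(\<^sub>1\<^sub>), \<dots>, X\<^sub>s\<^sub>(\<^sub>n\<^sub>))\<close> and \<open>(X\<^sub>1, \<dots>, X\<^sub>n)\<close> have the same product law
  (lemma \<open>distr_permuted_iid\<close>), so that every \<open>f\<^sub>n\<^sub>,\<^sub>s\<close> has the same expected divergence as \<open>f\<^sub>n\<close>.
  Jensen's inequality for the finite average over \<open>s\<close> (lemma \<open>convex_in_second_average\<close>) bounds the
  divergence of the averaged estimate by the average of the divergences, and taking expectations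
  yields the claim (lemma \<open>expectation_le_of_permutation_average\<close>). As forming a mixture is linear,
  the same argument applies to the mixture densities.

  Convexity of the divergence is available between probability densities only, so the iterates
  have to be probability densities almost surely. This can fail only when a normalising constant
  vanishes. Each iterate dominates a positive multiple of \<open>f\<^sub>0\<close> (lemma \<open>recursive_estimate_density\<close>),
  hence it suffices that the \<open>f\<^sub>0\<close>-mixture is positive at every observation. The uniform bound on the
  likelihood ratios forces all kernel densities to have essentially the same support
  (lemma \<open>AE_support_of_ratio_bound\<close>), and therefore the \<open>f\<^sub>0\<close>-mixture is positive almost
  everywhere with respect to the law of the data (lemma \<open>AE_mixture_pos\<close>). Boundedness of
  \<open>\<theta> \<mapsto> p(x|\<theta>)\<close> makes all the normalising constants finite.

  For the Kullback--Leibler and \<open>L\<^sub>1\<close> divergences, convexity is verified pointwise under the integral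
  and measurability in the data follows from joint measurability of the iterates in data and
  parameter.
\<close>

section \<open>Probability densities and convex divergences\<close>

lemma prob_densityD:
  assumes "prob_density M g"
  shows "g \<in> borel_measurable M" "\<And>x. x \<in> space M \<Longrightarrow> 0 \<le> g x"
    "(\<integral>\<^sup>+x. ennreal (g x) \<partial>M) = 1" "integrable M g" "(\<integral>x. g x \<partial>M) = 1"
proof -
  show m: "g \<in> borel_measurable M" and nn: "\<And>x. x \<in> space M \<Longrightarrow> 0 \<le> g x"
    and 1: "(\<integral>\<^sup>+x. ennreal (g x) \<partial>M) = 1"
    using assms by (auto simp: prob_density_def)
  have "AE x in M. 0 \<le> g x" using nn by auto
  with m 1 show "integrable M g" "(\<integral>x. g x \<partial>M) = 1"
    using nn_integral_eq_integrable[of g M 1] by auto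
qed

lemma prob_densityI_integrable:
  assumes "integrable M g" "\<And>x. x \<in> space M \<Longrightarrow> 0 \<le> g x" "(\<integral>x. g x \<partial>M) = 1"
  shows "prob_density M g"
proof -
  have "AE x in M. 0 \<le> g x" using assms(2) by auto
  with assms show ?thesis
    by (auto simp: prob_density_def nn_integral_eq_integral)
qed

lemma prob_density_convex_combination:
  assumes "prob_density M g" "prob_density M h" "0 \<le> t" "t \<le> 1"
  shows "prob_density M (\<lambda>x. (1 - t) * g x + t * h x)"
proof (rule prob_densityI_integrable)
  note g = prob_densityD[OF assms(1)] and h = prob_densityD[OF assms(2)]
  show "integrable M (\<lambda>x. (1 - t) * g x + t * h x)" using g(4) h(4) by simp
  show "0 \<le> (1 - t) * g x + t * h x" if "x \<in> space M" for x
    using g(2)[OF that] h(2)[OF that] assms(3,4) by (intro add_nonneg_nonneg mult_nonneg_nonneg) auto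
  show "(\<integral>x. (1 - t) * g x + t * h x \<partial>M) = 1" using g(4,5) h(4,5) by simp
qed

text \<open>Jensen's inequality for a uniform finite average, by adding one member at a time with weight
  \<open>1 / (card S + 1)\<close>. The induction carries along that the average is a density, because convexity
  is assumed between probability densities.\<close>

lemma convex_in_second_average:
  assumes d: "convex_in_second M d" and g: "prob_density M g"
    and S: "finite S" "S \<noteq> {}" and h: "\<And>s. s \<in> S \<Longrightarrow> prob_density M (h s)"
  shows "prob_density M (\<lambda>x. 1 / real (card S) * (\<Sum>s\<in>S. h s x)) \<and>
    d g (\<lambda>x. 1 / real (card S) * (\<Sum>s\<in>S. h s x)) \<le> ennreal (1 / real (card S)) * (\<Sum>s\<in>S. d g (h s))"
  using S h
proof (induction S rule: finite_ne_induct)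
  case (singleton s)
  then show ?case by simp
next
  case (insert s S)
  define c where "c = real (card S)"
  define t where "t = 1 / (c + 1)"
  have c: "0 < c" using insert.hyps by (simp add: c_def card_gt_0_iff)
  have t: "0 \<le> t" "t \<le> 1" "(1 - t) * (1 / c) = t" using c by (auto simp: t_def field_simps)
  have card: "1 / real (card (insert s S)) = t"
    using insert.hyps by (simp add: t_def c_def add.commute)
  let ?avg = "\<lambda>x. 1 / c * (\<Sum>s\<in>S. h s x)"
  have avg: "prob_density M ?avg" "d g ?avg \<le> ennreal (1 / c) * (\<Sum>s\<in>S. d g (h s))"
    using insert.IH insert.prems by (auto simp: c_def)
  have hs: "prob_density M (h s)" using insert.prems by auto
  have split: "(\<lambda>x. t * (\<Sum>s\<in>insert s S. h s x)) = (\<lambda>x. (1 - t) * ?avg x + t * h s x)"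
  proof
    fix x
    have "(1 - t) * ?avg x = t * (\<Sum>s\<in>S. h s x)"
      using t(3) by (metis mult.assoc)
    then show "t * (\<Sum>s\<in>insert s S. h s x) = (1 - t) * ?avg x + t * h s x"
      using insert.hyps by (simp add: distrib_left)
  qed
  have "d g (\<lambda>x. (1 - t) * ?avg x + t * h s x) \<le> ennreal (1 - t) * d g ?avg + ennreal t * d g (h s)"
    using d g avg(1) hs t(1,2) unfolding convex_in_second_def by blast
  also have "\<dots> \<le> ennreal (1 - t) * (ennreal (1 / c) * (\<Sum>s\<in>S. d g (h s))) + ennreal t * d g (h s)"
    by (intro add_right_mono mult_left_mono avg) auto
  also have "ennreal (1 - t) * (ennreal (1 / c) * (\<Sum>s\<in>S. d g (h s))) = ennreal t * (\<Sum>s\<in>S. d g (h s))"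
    using t c by (metis mult.assoc ennreal_mult diff_ge_0_iff_ge zero_le_divide_1_iff less_imp_le)
  also have "\<dots> + ennreal t * d g (h s) = ennreal t * (\<Sum>s\<in>insert s S. d g (h s))"
    using insert.hyps by (simp add: distrib_left add.commute)
  finally show ?case
    using prob_density_convex_combination[OF avg(1) hs t(1,2)] unfolding card split by blast
qed

section \<open>The \<open>L\<^sub>1\<close> distance and the Kullback--Leibler divergence\<close>

lemma convex_in_second_l1_dist: "convex_in_second M (l1_dist M)"
  unfolding convex_in_second_def
proof (intro allI impI, elim conjE)
  fix g h1 h2 :: "'a \<Rightarrow> real" and t :: real
  assume "prob_density M g" "prob_density M h1" "prob_density M h2" and t: "0 \<le> t" "t \<le> 1"
  note [measurable] = this(1-3)[THEN prob_densityD(1)]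
  have "l1_dist M g (\<lambda>x. (1 - t) * h1 x + t * h2 x)
      \<le> (\<integral>\<^sup>+x. ennreal (1 - t) * ennreal \<bar>g x - h1 x\<bar> + ennreal t * ennreal \<bar>g x - h2 x\<bar> \<partial>M)"
    unfolding l1_dist_def
  proof (rule nn_integral_mono)
    fix x
    have "g x - ((1 - t) * h1 x + t * h2 x) = (1 - t) * (g x - h1 x) + t * (g x - h2 x)"
      by (simp add: algebra_simps)
    then have "\<bar>g x - ((1 - t) * h1 x + t * h2 x)\<bar> \<le> (1 - t) * \<bar>g x - h1 x\<bar> + t * \<bar>g x - h2 x\<bar>"
      using abs_triangle_ineq[of "(1 - t) * (g x - h1 x)" "t * (g x - h2 x)"] t
      by (simp add: abs_mult)
    then show "ennreal \<bar>g x - ((1 - t) * h1 x + t * h2 x)\<bar>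
        \<le> ennreal (1 - t) * ennreal \<bar>g x - h1 x\<bar> + ennreal t * ennreal \<bar>g x - h2 x\<bar>"
      using t by (simp add: ennreal_mult[symmetric] ennreal_plus[symmetric] ennreal_leI
          del: ennreal_plus)
  qed
  also have "\<dots> = ennreal (1 - t) * l1_dist M g h1 + ennreal t * l1_dist M g h2"
    unfolding l1_dist_def by (simp add: nn_integral_add nn_integral_cmult)
  finally show "l1_dist M g (\<lambda>x. (1 - t) * h1 x + t * h2 x)
      \<le> ennreal (1 - t) * l1_dist M g h1 + ennreal t * l1_dist M g h2" .
qed

text \<open>The Bregman form of the Kullback--Leibler integrand. Adding \<open>b - a\<close> makes the integrand
  nonnegative and does not change its integral when both arguments are probability densities, so
  that convexity can be read off pointwise in \<^typ>\<open>ennreal\<close>.\<close>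

definition kl_bregman :: "real \<Rightarrow> real \<Rightarrow> ennreal" where
  "kl_bregman a b =
     (if a = 0 then ennreal b else if b = 0 then \<infinity> else ennreal (a * ln (a / b) + b - a))"

lemma mult_ln_divide_ge:
  fixes a b :: real
  assumes "0 < a" "0 < b"
  shows "a - b \<le> a * ln (a / b)"
proof -
  have "a * ln (b / a) \<le> a * (b / a - 1)"
    using assms by (intro mult_left_mono ln_le_minus_one) auto
  also have "\<dots> = b - a" using assms by (simp add: field_simps)
  finally show ?thesis using assms by (simp add: ln_div algebra_simps)
qed

lemma kl_bregman_convex:
  assumes "0 \<le> a" "0 \<le> b" "0 \<le> c" "0 \<le> t" "t \<le> 1"
  shows "kl_bregman a ((1 - t) * b + t * c) \<le> ennreal (1 - t) * kl_bregman a b + ennreal t * kl_bregman a c"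
proof -
  consider "t = 0" | "t = 1" | "0 < t" "t < 1" "a = 0" | "0 < t" "t < 1" "0 < a" "b = 0 \<or> c = 0"
    | "0 < t" "t < 1" "0 < a" "0 < b" "0 < c"
    using assms by linarith
  then show ?thesis
  proof cases
    case 3
    then show ?thesis using assms
      by (simp add: kl_bregman_def ennreal_mult[symmetric] ennreal_plus[symmetric] del: ennreal_plus)
  next
    case 4
    then have top: "ennreal (1 - t) * kl_bregman a b + ennreal t * kl_bregman a c = top"
      by (auto simp: kl_bregman_def ennreal_mult_eq_top_iff ennreal_mult_top)
    show ?thesis unfolding top by (rule top_greatest)
  next
    case 5
    let ?m = "(1 - t) * b + t * c"
    have m: "0 < ?m" using 5 by (simp add: add_pos_pos)
    have "(1 - t) * ln b + t * ln c \<le> ln ?m"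
      using concave_onD[OF ln_concave, of t b c] 5 by simp
    from mult_left_mono[OF this, of a]
    have "a * ln (a / ?m) + ?m - a
        \<le> (1 - t) * (a * ln (a / b) + b - a) + t * (a * ln (a / c) + c - a)"
      using 5 m by (simp add: ln_div algebra_simps)
    moreover have "0 \<le> a * ln (a / b) + b - a" "0 \<le> a * ln (a / c) + c - a"
      using mult_ln_divide_ge[of a b] mult_ln_divide_ge[of a c] 5 by auto
    ultimately show ?thesis
      using 5 m by (simp add: kl_bregman_def ennreal_mult[symmetric] ennreal_plus[symmetric]
          ennreal_leI del: ennreal_plus)
  qed (simp_all)
qed

lemma borel_measurable_kl_integrand[measurable (raw)]:
  assumes [measurable]: "g \<in> borel_measurable N" "h \<in> borel_measurable N"
  shows "(\<lambda>x. kl_integrand (g x) (h x)) \<in> borel_measurable N"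
  unfolding kl_integrand_def by measurable

lemma borel_measurable_kl_bregman[measurable (raw)]:
  assumes [measurable]: "g \<in> borel_measurable N" "h \<in> borel_measurable N"
  shows "(\<lambda>x. kl_bregman (g x) (h x)) \<in> borel_measurable N"
  unfolding kl_bregman_def by measurable

text \<open>The identity \<open>\<phi> + (a log (a / b))\<^sup>- + a = (a log (a / b))\<^sup>+ + b\<close> for the Bregman form \<open>\<phi>\<close>, free
  of subtractions so that it can be integrated term by term in \<^typ>\<open>ennreal\<close>. The bound on the
  negative part makes its integral finite, hence cancellable.\<close>

lemma kl_integrand_parts:
  assumes "0 \<le> a" "0 \<le> b"
  shows "kl_bregman a b + e2ennreal (- kl_integrand a b) + ennreal a
      = e2ennreal (kl_integrand a b) + ennreal b"
    and "e2ennreal (- kl_integrand a b) \<le> ennreal b"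
proof -
  consider "a = 0" | "0 < a" "b = 0" | "0 < a" "0 < b" using assms by linarith
  then have "kl_bregman a b + e2ennreal (- kl_integrand a b) + ennreal a
      = e2ennreal (kl_integrand a b) + ennreal b \<and> e2ennreal (- kl_integrand a b) \<le> ennreal b"
  proof cases
    case 1
    then show ?thesis by (simp add: kl_bregman_def kl_integrand_def e2ennreal_neg)
  next
    case 2
    then show ?thesis by (simp add: kl_bregman_def kl_integrand_def e2ennreal_neg)
  next
    case 3
    define l where "l = a * ln (a / b)"
    have l: "a - b \<le> l" using mult_ln_divide_ge 3 by (simp add: l_def)
    have "ennreal (l + b - a) + ennreal (- l) + ennreal a = ennreal l + ennreal b"
    proof (cases "0 \<le> l")
      case True
      then show ?thesis using l 3
        by (simp add: ennreal_neg ennreal_plus[symmetric] del: ennreal_plus)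
    next
      case False
      then show ?thesis using l 3
        by (simp add: ennreal_neg ennreal_plus[symmetric] del: ennreal_plus)
    qed
    moreover have "ennreal (- l) \<le> ennreal b" using l 3 by (intro ennreal_leI) simp
    ultimately show ?thesis using 3 by (simp add: kl_bregman_def kl_integrand_def l_def)
  qed
  then show "kl_bregman a b + e2ennreal (- kl_integrand a b) + ennreal a
      = e2ennreal (kl_integrand a b) + ennreal b" "e2ennreal (- kl_integrand a b) \<le> ennreal b"
    by auto
qed

lemma kl_div_eq_kl_bregman:
  assumes g: "prob_density M g" and h: "prob_density M h"
  shows "kl_div M g h = (\<integral>\<^sup>+x. kl_bregman (g x) (h x) \<partial>M)"
proof -
  note [measurable] = prob_densityD(1)[OF g] prob_densityD(1)[OF h]
  note nonneg = prob_densityD(2)[OF g] prob_densityD(2)[OF h]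
  let ?P = "\<integral>\<^sup>+x. e2ennreal (kl_integrand (g x) (h x)) \<partial>M"
  let ?N = "\<integral>\<^sup>+x. e2ennreal (- kl_integrand (g x) (h x)) \<partial>M"
  let ?B = "\<integral>\<^sup>+x. kl_bregman (g x) (h x) \<partial>M"
  have "?N \<le> (\<integral>\<^sup>+x. ennreal (h x) \<partial>M)"
    using nonneg by (intro nn_integral_mono kl_integrand_parts)
  then have N: "?N \<noteq> \<infinity>" using prob_densityD(3)[OF h] by (auto simp: top_unique)
  have "(?B + ?N) + (\<integral>\<^sup>+x. ennreal (g x) \<partial>M)
      = (\<integral>\<^sup>+x. kl_bregman (g x) (h x) + e2ennreal (- kl_integrand (g x) (h x)) + ennreal (g x) \<partial>M)"
    by (simp add: nn_integral_add)
  also have "\<dots> = (\<integral>\<^sup>+x. e2ennreal (kl_integrand (g x) (h x)) + ennreal (h x) \<partial>M)"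
    using nonneg by (intro nn_integral_cong kl_integrand_parts)
  also have "\<dots> = ?P + (\<integral>\<^sup>+x. ennreal (h x) \<partial>M)" by (simp add: nn_integral_add)
  finally have sum: "?P = ?B + ?N"
    using prob_densityD(3)[OF g] prob_densityD(3)[OF h]
    by (simp add: ennreal_add_left_cancel add.commute[of _ 1])
  have "kl_div M g h = (?B + ?N) - ?N" unfolding kl_div_def sum ..
  also have "\<dots> = ?B" using N by (simp add: ennreal_add_diff_cancel_right)
  finally show ?thesis .
qed

lemma convex_in_second_kl_div: "convex_in_second M (kl_div M)"
  unfolding convex_in_second_def
proof (intro allI impI, elim conjE)
  fix g h1 h2 :: "'a \<Rightarrow> real" and t :: real
  assume g: "prob_density M g" and h: "prob_density M h1" "prob_density M h2" and t: "0 \<le> t" "t \<le> 1"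
  note [measurable] = g[THEN prob_densityD(1)] h[THEN prob_densityD(1)]
  have "kl_div M g (\<lambda>x. (1 - t) * h1 x + t * h2 x)
      = (\<integral>\<^sup>+x. kl_bregman (g x) ((1 - t) * h1 x + t * h2 x) \<partial>M)"
    by (intro kl_div_eq_kl_bregman g prob_density_convex_combination h t)
  also have "\<dots> \<le> (\<integral>\<^sup>+x. ennreal (1 - t) * kl_bregman (g x) (h1 x)
      + ennreal t * kl_bregman (g x) (h2 x) \<partial>M)"
    using prob_densityD(2)[OF g] prob_densityD(2)[OF h(1)] prob_densityD(2)[OF h(2)] t
    by (intro nn_integral_mono kl_bregman_convex)
  also have "\<dots> = ennreal (1 - t) * kl_div M g h1 + ennreal t * kl_div M g h2"
    by (simp add: nn_integral_add nn_integral_cmult kl_div_eq_kl_bregman g h)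
  finally show "kl_div M g (\<lambda>x. (1 - t) * h1 x + t * h2 x)
      \<le> ennreal (1 - t) * kl_div M g h1 + ennreal t * kl_div M g h2" .
qed

lemma (in sigma_finite_measure) borel_measurable_l1_dist:
  assumes [measurable]: "g \<in> borel_measurable M" "(\<lambda>(y, x). h y x) \<in> borel_measurable (N \<Otimes>\<^sub>M M)"
  shows "(\<lambda>y. l1_dist M g (h y)) \<in> borel_measurable N"
  unfolding l1_dist_def by measurable

lemma (in sigma_finite_measure) borel_measurable_kl_div:
  assumes [measurable]: "g \<in> borel_measurable M" "(\<lambda>(y, x). h y x) \<in> borel_measurable (N \<Otimes>\<^sub>M M)"
  shows "(\<lambda>y. kl_div M g (h y)) \<in> borel_measurable N"
  unfolding kl_div_def by measurable

section \<open>Exchangeable data\<close>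

text \<open>Both vectors are coordinate images of the product measure, which a permutation of the
  coordinates leaves invariant.\<close>

lemma (in prob_space) distr_permuted_iid:
  assumes indep: "indep_vars (\<lambda>_. N) X J" and distr: "\<And>i. i \<in> J \<Longrightarrow> distr M N (X i) = Q"
    and I: "I \<noteq> {}" "I \<subseteq> J" and s: "s permutes I"
  shows "distr M (PiM I (\<lambda>_. N)) (\<lambda>\<omega>. \<lambda>i\<in>I. X (s i) \<omega>) = PiM I (\<lambda>_. Q)"
proof -
  have s_in: "s i \<in> I" if "i \<in> I" for i using permutes_in_image[OF s] that by simp
  have rv: "random_variable N (X i)" if "i \<in> J" for i
    using indep that by (simp add: indep_vars_def2)
  have "indep_vars (\<lambda>_. N) X I" using indep I(2) by (rule indep_vars_subset)
  then have X: "distr M (PiM I (\<lambda>_. N)) (\<lambda>\<omega>. \<lambda>i\<in>I. X i \<omega>) = PiM I (\<lambda>i. distr M N (X i))"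
    using I rv by (subst (asm) indep_vars_iff_distr_eq_PiM') auto
  also have "\<dots> = PiM I (\<lambda>_. Q)" using I distr by (intro PiM_cong) auto
  finally have law: "distr M (PiM I (\<lambda>_. N)) (\<lambda>\<omega>. \<lambda>i\<in>I. X i \<omega>) = PiM I (\<lambda>_. Q)" .
  obtain i0 where "i0 \<in> I" using I by auto
  then have Q: "prob_space Q" "sets Q = sets N"
    using distr[of i0, symmetric] rv[of i0] I(2) by (auto intro: prob_space_distr)
  have "distr M (PiM I (\<lambda>_. N)) (\<lambda>\<omega>. \<lambda>i\<in>I. X (s i) \<omega>)
      = distr (distr M (PiM I (\<lambda>_. N)) (\<lambda>\<omega>. \<lambda>i\<in>I. X i \<omega>)) (PiM I (\<lambda>_. N)) (\<lambda>y. \<lambda>i\<in>I. y (s i))"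
    using s_in rv I(2)
    by (subst distr_distr) (auto intro!: distr_cong measurable_restrict
        simp: measurable_component_singleton fun_eq_iff o_def)
  also have "\<dots> = distr (PiM I (\<lambda>_. Q)) (PiM I (\<lambda>_. Q)) (\<lambda>y. \<lambda>i\<in>I. y (s i))"
    unfolding law by (intro distr_cong sets_PiM_cong) (auto simp: Q)
  also have "\<dots> = PiM I (\<lambda>_. Q)"
    using s_in Q by (intro distr_PiM_reindex) (auto intro: inj_on_subset[OF permutes_inj[OF s]])
  finally show ?thesis .
qed

text \<open>The measurability hypothesis lives on the product over \<open>I\<close>, whose points are extensional
  functions, while \<open>\<phi>\<close> is evaluated at whole sequences; invariance under restriction to \<open>I\<close> links the
  two.\<close>

lemma (in prob_space) expectation_le_of_permutation_average:
  assumes indep: "indep_vars (\<lambda>_. N) X J" and distr: "\<And>i. i \<in> J \<Longrightarrow> distr M N (X i) = Q"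
    and I: "finite I" "I \<noteq> {}" "I \<subseteq> J"
    and \<phi>[measurable]: "\<phi> \<in> borel_measurable (PiM I (\<lambda>_. N))"
    and local: "\<And>x. \<phi> (restrict x I) = \<phi> x"
    and le: "AE \<omega> in M. \<psi> \<omega> \<le> ennreal (1 / fact (card I)) * (\<Sum>s | s permutes I. \<phi> (\<lambda>i. X (s i) \<omega>))"
  shows "(\<integral>\<^sup>+\<omega>. \<psi> \<omega> \<partial>M) \<le> (\<integral>\<^sup>+\<omega>. \<phi> (\<lambda>i. X i \<omega>) \<partial>M)"
proof -
  have rv: "random_variable N (X i)" if "i \<in> I" for i
    using indep that I by (auto simp: indep_vars_def2)
  have meas: "(\<lambda>\<omega>. \<lambda>i\<in>I. X (s i) \<omega>) \<in> measurable M (PiM I (\<lambda>_. N))" if "s permutes I" for s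
    using rv permutes_in_image[OF that] by (intro measurable_restrict) auto
  have m: "(\<lambda>\<omega>. \<phi> (\<lambda>i. X (s i) \<omega>)) \<in> borel_measurable M" if "s permutes I" for s
    using measurable_compose[OF meas[OF that] \<phi>] local[of "\<lambda>i. X (s i) _"] by simp
  have law: "(\<integral>\<^sup>+\<omega>. \<phi> (\<lambda>i. X (s i) \<omega>) \<partial>M) = (\<integral>\<^sup>+y. \<phi> y \<partial>PiM I (\<lambda>_. Q))" if s: "s permutes I" for s
  proof -
    have "(\<integral>\<^sup>+y. \<phi> y \<partial>PiM I (\<lambda>_. Q))
        = (\<integral>\<^sup>+y. \<phi> y \<partial>distr M (PiM I (\<lambda>_. N)) (\<lambda>\<omega>. \<lambda>i\<in>I. X (s i) \<omega>))"
      by (simp only: distr_permuted_iid[OF indep distr I(2,3) s])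
    also have "\<dots> = (\<integral>\<^sup>+\<omega>. \<phi> (\<lambda>i\<in>I. X (s i) \<omega>) \<partial>M)"
      by (rule nn_integral_distr[OF meas[OF s]]) simp
    finally show ?thesis by (simp add: local)
  qed
  define c where "c = (\<integral>\<^sup>+y. \<phi> y \<partial>PiM I (\<lambda>_. Q))"
  have "(\<integral>\<^sup>+\<omega>. \<psi> \<omega> \<partial>M)
      \<le> (\<integral>\<^sup>+\<omega>. ennreal (1 / fact (card I)) * (\<Sum>s | s permutes I. \<phi> (\<lambda>i. X (s i) \<omega>)) \<partial>M)"
    using le by (rule nn_integral_mono_AE)
  also have "\<dots> = ennreal (1 / fact (card I)) * (\<integral>\<^sup>+\<omega>. (\<Sum>s | s permutes I. \<phi> (\<lambda>i. X (s i) \<omega>)) \<partial>M)"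
    using m by (intro nn_integral_cmult borel_measurable_sum) auto
  also have "(\<integral>\<^sup>+\<omega>. (\<Sum>s | s permutes I. \<phi> (\<lambda>i. X (s i) \<omega>)) \<partial>M)
      = (\<Sum>s | s permutes I. \<integral>\<^sup>+\<omega>. \<phi> (\<lambda>i. X (s i) \<omega>) \<partial>M)"
    using m by (intro nn_integral_sum) auto
  also have "\<dots> = (\<Sum>s | s permutes I. c)"
    using law by (intro sum.cong) (auto simp: c_def)
  also have "ennreal (1 / fact (card I)) * \<dots> = ennreal (1 / fact (card I)) * (ennreal (fact (card I)) * c)"
    by (simp add: card_permutations[OF refl I(1)] ennreal_of_nat_eq_real_of_nat)
  also have "\<dots> = c"
    by (simp add: mult.assoc[symmetric] ennreal_mult[symmetric])
  also have "\<dots> = (\<integral>\<^sup>+\<omega>. \<phi> (\<lambda>i. X i \<omega>) \<partial>M)"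
    using law[OF permutes_id] by (simp add: c_def)
  finally show ?thesis .
qed

section \<open>Mixtures over a bounded kernel\<close>

lemma AE_eq_0_of_nn_integral_eq_0:
  assumes "u \<in> borel_measurable M" "(\<integral>\<^sup>+x. u x \<partial>M) = 0"
  shows "AE x in M. u x = 0"
  using assms by (simp add: nn_integral_0_iff_AE)

text \<open>Where \<open>b\<close> vanishes and \<open>a\<close> does not, the ratio is infinite and weighted by a positive
  number, so a finite integral allows this only on a null set. Applied to
  pairs of kernel densities, this shows that they all have, up to null sets, the same support.\<close>

lemma AE_support_of_ratio_bound:
  fixes a b :: "'a \<Rightarrow> real"
  assumes [measurable]: "a \<in> borel_measurable M" "b \<in> borel_measurable M" and nonneg: "\<And>x. 0 \<le> b x"
    and fin: "(\<integral>\<^sup>+x. (ennreal (a x) / ennreal (b x))\<^sup>2 * ennreal (a x) \<partial>M) < \<infinity>"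
  shows "AE x in M. 0 < a x \<longrightarrow> 0 < b x"
proof -
  have "AE x in M. (ennreal (a x) / ennreal (b x))\<^sup>2 * ennreal (a x) \<noteq> \<infinity>"
    using fin by (intro nn_integral_PInf_AE) auto
  then show ?thesis
  proof eventually_elim
    case (elim x)
    show ?case
    proof
      assume a: "0 < a x"
      have "b x \<noteq> 0"
      proof
        assume "b x = 0"
        with a have "ennreal (a x) / ennreal (b x) = top" by (simp add: ennreal_divide_zero)
        with a elim show False by (simp add: ennreal_top_mult)
      qed
      with nonneg[of x] show "0 < b x" by simp
    qed
  qed
qed

locale mixture_model = X: sigma_finite_measure \<nu> + T: sigma_finite_measure \<mu>
  for \<nu> :: "'a::topological_space measure" and \<mu> :: "'b::topological_space measure" +
  fixes k :: "'a \<Rightarrow> 'b \<Rightarrow> real"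
  assumes sets_\<nu>[measurable_cong]: "sets \<nu> = sets borel"
    and sets_\<mu>[measurable_cong]: "sets \<mu> = sets borel"
    and kernel_measurable: "(\<lambda>(x, \<theta>). k x \<theta>) \<in> borel_measurable (borel \<Otimes>\<^sub>M borel)"
    and kernel_density: "\<And>\<theta>. prob_density \<nu> (\<lambda>x. k x \<theta>)"
    and kernel_bounded: "\<And>x. bounded (range (k x))"
begin

lemma space_\<nu>[simp]: "space \<nu> = UNIV" and space_\<mu>[simp]: "space \<mu> = UNIV"
  using sets_eq_imp_space_eq[OF sets_\<nu>] sets_eq_imp_space_eq[OF sets_\<mu>] by simp_all

lemma kernel_measurable'[measurable (raw)]:
  "g \<in> measurable N borel \<Longrightarrow> h \<in> measurable N borel \<Longrightarrow> (\<lambda>y. k (g y) (h y)) \<in> borel_measurable N"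
  using measurable_compose[OF measurable_Pair kernel_measurable, of g N h] by simp

lemma kernel_nonneg[simp]: "0 \<le> k x \<theta>"
  using prob_densityD(2)[OF kernel_density] by simp

lemma integrable_kernel_times:
  assumes "integrable \<mu> g"
  shows "integrable \<mu> (\<lambda>\<theta>. k x \<theta> * g \<theta>)"
proof -
  obtain B where "\<And>\<theta>. norm (k x \<theta>) \<le> B"
    using kernel_bounded[of x] by (auto simp: bounded_iff)
  then have B: "norm (k x \<theta> * g \<theta>) \<le> norm (B * g \<theta>)" for \<theta>
    by (simp add: abs_mult mult_right_mono order_trans[OF _ abs_ge_self])
  have [measurable]: "g \<in> borel_measurable \<mu>" using assms by auto
  show ?thesis
    by (rule Bochner_Integration.integrable_bound[of \<mu> "\<lambda>\<theta>. B * g \<theta>"]) (use assms B in auto)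
qed

lemma ennreal_mixture:
  assumes "prob_density \<mu> g"
  shows "ennreal (mixture \<mu> k g x) = (\<integral>\<^sup>+\<theta>. ennreal (k x \<theta>) * ennreal (g \<theta>) \<partial>\<mu>)"
  using integrable_kernel_times[OF prob_densityD(4)[OF assms], of x] prob_densityD(2)[OF assms]
  by (simp add: mixture_def nn_integral_eq_integral[symmetric] ennreal_mult)

lemma mixture_nonneg:
  assumes "prob_density \<mu> g"
  shows "0 \<le> mixture \<mu> k g x"
  using prob_densityD(2)[OF assms] by (simp add: mixture_def integral_nonneg_AE)

lemma borel_measurable_mixture:
  assumes [measurable]: "(\<lambda>(y, \<theta>). g y \<theta>) \<in> borel_measurable (N \<Otimes>\<^sub>M \<mu>)"
  shows "(\<lambda>(y, x). mixture \<mu> k (g y) x) \<in> borel_measurable (N \<Otimes>\<^sub>M \<nu>)"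
  unfolding mixture_def by measurable

lemma borel_measurable_mixture1[measurable]:
  assumes [measurable]: "g \<in> borel_measurable \<mu>"
  shows "mixture \<mu> k g \<in> borel_measurable \<nu>"
  unfolding mixture_def[abs_def] by measurable

text \<open>Tonelli's theorem: the mixture gives a set the average of the masses that the kernel
  densities give to it.\<close>

lemma nn_integral_mixture_indicator:
  assumes g: "prob_density \<mu> g" and A[measurable]: "A \<in> sets \<nu>"
  shows "(\<integral>\<^sup>+x. ennreal (mixture \<mu> k g x) * indicator A x \<partial>\<nu>)
    = (\<integral>\<^sup>+\<theta>. ennreal (g \<theta>) * (\<integral>\<^sup>+x. ennreal (k x \<theta>) * indicator A x \<partial>\<nu>) \<partial>\<mu>)"
proof -
  interpret pair_sigma_finite \<nu> \<mu> ..
  have [measurable]: "g \<in> borel_measurable \<mu>" using prob_densityD[OF g] by auto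
  have "(\<integral>\<^sup>+x. ennreal (mixture \<mu> k g x) * indicator A x \<partial>\<nu>)
      = (\<integral>\<^sup>+x. (\<integral>\<^sup>+\<theta>. ennreal (g \<theta>) * (ennreal (k x \<theta>) * indicator A x) \<partial>\<mu>) \<partial>\<nu>)"
  proof (rule nn_integral_cong)
    fix x
    have "ennreal (mixture \<mu> k g x) * indicator A x
        = (\<integral>\<^sup>+\<theta>. ennreal (k x \<theta>) * ennreal (g \<theta>) * indicator A x \<partial>\<mu>)"
      unfolding ennreal_mixture[OF g] by (rule nn_integral_multc[symmetric]) measurable
    then show "ennreal (mixture \<mu> k g x) * indicator A x
        = (\<integral>\<^sup>+\<theta>. ennreal (g \<theta>) * (ennreal (k x \<theta>) * indicator A x) \<partial>\<mu>)"
      by (simp only: mult_ac)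
  qed
  also have "\<dots> = (\<integral>\<^sup>+\<theta>. (\<integral>\<^sup>+x. ennreal (g \<theta>) * (ennreal (k x \<theta>) * indicator A x) \<partial>\<nu>) \<partial>\<mu>)"
    by (rule Fubini'[symmetric]) measurable
  also have "\<dots> = (\<integral>\<^sup>+\<theta>. ennreal (g \<theta>) * (\<integral>\<^sup>+x. ennreal (k x \<theta>) * indicator A x \<partial>\<nu>) \<partial>\<mu>)"
    by (intro nn_integral_cong nn_integral_cmult) measurable
  finally show ?thesis .
qed

lemma prob_density_mixture:
  assumes "prob_density \<mu> g"
  shows "prob_density \<nu> (mixture \<mu> k g)"
  using nn_integral_mixture_indicator[OF assms, of UNIV] prob_densityD(1,3)[OF assms]
    prob_densityD(3)[OF kernel_density] mixture_nonneg[OF assms]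
  by (simp add: prob_density_def sets_\<nu>)

text \<open>Let \<open>Z\<close> be the zero set of the \<open>h\<close>-mixture. Some kernel density gives no mass to \<open>Z\<close>; since all
  kernel densities share their support, none does, and hence neither does the \<open>g\<close>-mixture.\<close>

lemma AE_mixture_pos:
  assumes supp: "\<And>\<theta>1 \<theta>2. AE x in \<nu>. 0 < k x \<theta>1 \<longrightarrow> 0 < k x \<theta>2"
    and g: "prob_density \<mu> g" and h: "prob_density \<mu> h"
  shows "AE x in density \<nu> (\<lambda>x. ennreal (mixture \<mu> k g x)). 0 < mixture \<mu> k h x"
proof -
  have [measurable]: "g \<in> borel_measurable \<mu>" "h \<in> borel_measurable \<mu>"
    using prob_densityD(1)[OF g] prob_densityD(1)[OF h] by auto
  define Z where "Z = {x \<in> space \<nu>. mixture \<mu> k h x = 0}"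
  have Z[measurable]: "Z \<in> sets \<nu>" unfolding Z_def by measurable
  let ?I = "\<lambda>\<theta>. \<integral>\<^sup>+x. ennreal (k x \<theta>) * indicator Z x \<partial>\<nu>"
  have "(\<integral>\<^sup>+\<theta>. ennreal (h \<theta>) * ?I \<theta> \<partial>\<mu>) = (\<integral>\<^sup>+x. ennreal (mixture \<mu> k h x) * indicator Z x \<partial>\<nu>)"
    by (rule nn_integral_mixture_indicator[OF h Z, symmetric])
  also have "\<dots> = (\<integral>\<^sup>+x. 0 \<partial>\<nu>)"
    by (intro nn_integral_cong) (auto simp: Z_def indicator_def)
  finally have ae: "AE \<theta> in \<mu>. ennreal (h \<theta>) * ?I \<theta> = 0"
    by (intro AE_eq_0_of_nn_integral_eq_0) auto
  \<comment> \<open>Since \<open>h\<close> has total mass one, some parameter of positive \<open>h\<close>-density gives no mass to \<open>Z\<close>.\<close>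
  obtain \<theta>2 where \<theta>2: "?I \<theta>2 = 0"
  proof (rule ccontr)
    assume "\<not> thesis"
    then have "?I \<theta> \<noteq> 0" for \<theta> using that by blast
    with ae have "AE \<theta> in \<mu>. ennreal (h \<theta>) = 0" by auto
    then have "(\<integral>\<^sup>+\<theta>. ennreal (h \<theta>) \<partial>\<mu>) = 0" by (subst nn_integral_0_iff_AE) auto
    then show False using prob_densityD(3)[OF h] by simp
  qed
  then have \<theta>2_ae: "AE x in \<nu>. ennreal (k x \<theta>2) * indicator Z x = 0"
    by (intro AE_eq_0_of_nn_integral_eq_0) auto
  have "?I \<theta> = 0" for \<theta>
  proof (subst nn_integral_0_iff_AE)
    show "AE x in \<nu>. ennreal (k x \<theta>) * indicator Z x = 0"
      using \<theta>2_ae supp[of \<theta> \<theta>2]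
      by eventually_elim (auto simp: indicator_def ennreal_eq_0_iff not_less split: if_splits)
  qed measurable
  then have "(\<integral>\<^sup>+x. ennreal (mixture \<mu> k g x) * indicator Z x \<partial>\<nu>) = 0"
    by (simp add: nn_integral_mixture_indicator[OF g Z])
  then have "AE x in \<nu>. ennreal (mixture \<mu> k g x) * indicator Z x = 0"
    by (intro AE_eq_0_of_nn_integral_eq_0) auto
  then have "AE x in \<nu>. 0 < ennreal (mixture \<mu> k g x) \<longrightarrow> 0 < mixture \<mu> k h x"
    by eventually_elim
      (use mixture_nonneg[OF h] in \<open>auto simp: Z_def indicator_def order_less_le split: if_splits\<close>)
  then show ?thesis by (subst AE_density) auto
qed

section \<open>The recursive estimate\<close>

text \<open>The lower bound by a multiple of \<open>f0\<close> (the factor shrinks by \<open>1 - w i\<close> in step \<open>i\<close>) is what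
  keeps the next normalising constant positive.\<close>

lemma recursive_estimate_density:
  assumes f0: "prob_density \<mu> f0" and w: "\<And>i. i \<in> {1..n} \<Longrightarrow> 0 < w i \<and> w i < 1"
    and pos: "\<And>i. i \<in> {1..n} \<Longrightarrow> 0 < mixture \<mu> k f0 (x i)"
  shows "prob_density \<mu> (recursive_estimate \<mu> k f0 w x n) \<and>
    (\<exists>c>0. \<forall>\<theta>. c * f0 \<theta> \<le> recursive_estimate \<mu> k f0 w x n \<theta>)"
  using w pos
proof (induction n)
  case 0
  show ?case using f0 by (auto intro!: exI[of _ 1])
next
  case (Suc n)
  define r where "r = recursive_estimate \<mu> k f0 w x n"
  define m where "m = mixture \<mu> k r (x (Suc n))"
  define u where "u = (\<lambda>\<theta>. k (x (Suc n)) \<theta> * r \<theta> / m)"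
  define v where "v = w (Suc n)"
  have rec: "recursive_estimate \<mu> k f0 w x (Suc n) = (\<lambda>\<theta>. (1 - v) * r \<theta> + v * u \<theta>)"
    by (simp add: u_def m_def r_def mixture_def v_def)
  have v: "0 < v" "v < 1" using Suc.prems(1)[of "Suc n"] by (auto simp: v_def)
  obtain c where r: "prob_density \<mu> r" and c: "0 < c" "\<And>\<theta>. c * f0 \<theta> \<le> r \<theta>"
    using Suc.IH Suc.prems unfolding r_def by auto
  have int: "integrable \<mu> (\<lambda>\<theta>. k (x (Suc n)) \<theta> * r \<theta>)"
    by (rule integrable_kernel_times[OF prob_densityD(4)[OF r]])
  have "c * mixture \<mu> k f0 (x (Suc n)) = (\<integral>\<theta>. k (x (Suc n)) \<theta> * (c * f0 \<theta>) \<partial>\<mu>)"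
    by (simp add: mixture_def mult.left_commute)
  also have "\<dots> \<le> m" unfolding m_def mixture_def
    by (intro integral_mono integrable_kernel_times prob_densityD(4)[OF r] integrable_mult_right
        prob_densityD(4)[OF f0] mult_left_mono c kernel_nonneg)
  finally have "c * mixture \<mu> k f0 (x (Suc n)) \<le> m" .
  moreover have "0 < c * mixture \<mu> k f0 (x (Suc n))"
    using c(1) Suc.prems(2)[of "Suc n"] by simp
  ultimately have m: "0 < m" by linarith
  have u: "prob_density \<mu> u"
  proof (rule prob_densityI_integrable)
    show "integrable \<mu> u" unfolding u_def using int by simp
    show "0 \<le> u \<theta>" if "\<theta> \<in> space \<mu>" for \<theta>
      using m prob_densityD(2)[OF r] by (simp add: u_def)
    show "(\<integral>\<theta>. u \<theta> \<partial>\<mu>) = 1" using m by (simp add: u_def m_def mixture_def)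
  qed
  have "(1 - v) * c * f0 \<theta> \<le> (1 - v) * r \<theta> + v * u \<theta>" for \<theta>
  proof -
    have "(1 - v) * (c * f0 \<theta>) \<le> (1 - v) * r \<theta>" using v c(2) by (intro mult_left_mono) auto
    moreover have "0 \<le> v * u \<theta>" using v prob_densityD(2)[OF u] by simp
    ultimately show ?thesis by (simp add: mult.assoc)
  qed
  moreover have "0 < (1 - v) * c" using v c by simp
  ultimately show ?case
    unfolding rec using prob_density_convex_combination[OF r u] v by fastforce
qed

lemma borel_measurable_recursive_estimate:
  assumes f0[measurable]: "f0 \<in> borel_measurable \<mu>" and "{1..n} \<subseteq> I"
  shows "(\<lambda>(x, \<theta>). recursive_estimate \<mu> k f0 w x n \<theta>)
    \<in> borel_measurable (PiM I (\<lambda>_. borel) \<Otimes>\<^sub>M \<mu>)"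
  using assms(2)
proof (induction n)
  case 0
  show ?case by simp
next
  case (Suc n)
  have [measurable]: "(\<lambda>(x, \<theta>). recursive_estimate \<mu> k f0 w x n \<theta>)
      \<in> borel_measurable (PiM I (\<lambda>_. borel) \<Otimes>\<^sub>M \<mu>)"
    using Suc.prems by (intro Suc.IH) auto
  have [measurable]: "(\<lambda>x. x (Suc n)) \<in> measurable (PiM I (\<lambda>_. borel)) borel"
    using Suc.prems by (intro measurable_component_singleton) auto
  show ?case by simp
qed

end

lemma recursive_estimate_cong:
  assumes "\<And>i. i \<in> {1..n} \<Longrightarrow> x i = y i"
  shows "recursive_estimate \<mu> k f0 w x n = recursive_estimate \<mu> k f0 w y n"
  using assms by (induction n) auto

lemma (in mixture_model) mixture_average:
  assumes "\<And>s. s \<in> S \<Longrightarrow> integrable \<mu> (h s)"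
  shows "mixture \<mu> k (\<lambda>\<theta>. c * (\<Sum>s\<in>S. h s \<theta>)) = (\<lambda>x. c * (\<Sum>s\<in>S. mixture \<mu> k (h s) x))"
proof
  fix x
  have "mixture \<mu> k (\<lambda>\<theta>. c * (\<Sum>s\<in>S. h s \<theta>)) x = (\<integral>\<theta>. c * (\<Sum>s\<in>S. k x \<theta> * h s \<theta>) \<partial>\<mu>)"
    by (simp add: mixture_def sum_distrib_left mult_ac)
  also have "\<dots> = c * (\<Sum>s\<in>S. mixture \<mu> k (h s) x)"
    using assms by (simp add: mixture_def integrable_kernel_times)
  finally show "mixture \<mu> k (\<lambda>\<theta>. c * (\<Sum>s\<in>S. h s \<theta>)) x = c * (\<Sum>s\<in>S. mixture \<mu> k (h s) x)" .
qed

theorem mainTheorem6: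
  fixes \<nu> :: "'a::polish_space measure"
    and \<mu> F :: "'b::polish_space measure"
    and k :: "'a \<Rightarrow> 'b \<Rightarrow> real"
    and f f0 :: "'b \<Rightarrow> real"
    and w :: "nat \<Rightarrow> real"
    and M :: "'w measure"
    and X :: "nat \<Rightarrow> 'w \<Rightarrow> 'a"
  assumes "sets \<nu> = sets borel" "sigma_finite_measure \<nu>"
    and "sets \<mu> = sets borel" "sigma_finite_measure \<mu>"
    and "(\<lambda>(x, \<theta>). k x \<theta>) \<in> borel_measurable (borel \<Otimes>\<^sub>M borel)"
    and "\<And>\<theta>. prob_density \<nu> (\<lambda>x. k x \<theta>)"
    and "prob_space F" "F = density \<mu> (\<lambda>\<theta>. ennreal (f \<theta>))"
    and "f \<in> borel_measurable borel" "\<And>\<theta>. 0 \<le> f \<theta>"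
    and "prob_density \<mu> f0"
    and "\<And>i. 1 \<le> i \<Longrightarrow> 0 < w i \<and> w i < 1"
    and "prob_space M"
    and "prob_space.indep_vars M (\<lambda>_. borel) X {1..}"
    and "\<And>i. 1 \<le> i \<Longrightarrow> distributed M \<nu> (X i) (\<lambda>x. ennreal (mixture \<mu> k f x))"
    and A1: "\<not> summable (\<lambda>i. w (Suc i))" "summable (\<lambda>i. (w (Suc i))\<^sup>2)"
    and A2: "\<And>G H :: 'b measure.
      prob_space G \<Longrightarrow> sets G = sets borel \<Longrightarrow> prob_space H \<Longrightarrow> sets H = sets borel \<Longrightarrow>
      (AE x in \<nu>. (\<integral>\<theta>. k x \<theta> \<partial>G) = (\<integral>\<theta>. k x \<theta> \<partial>H)) \<Longrightarrow> G = H"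
    and A3: "\<And>x. bounded (range (k x)) \<and> continuous_on UNIV (k x)"
    and A4: "\<And>\<epsilon> X0. 0 < \<epsilon> \<Longrightarrow> compact X0 \<Longrightarrow>
      \<exists>T0. compact T0 \<and> (\<forall>\<theta>. \<theta> \<notin> T0 \<longrightarrow> (LINT x:X0|\<nu>. k x \<theta>) < \<epsilon>)"
    and A5: "\<exists>B::real. \<forall>\<theta>1 \<theta>2 \<theta>3.
      (\<integral>\<^sup>+x. (ennreal (k x \<theta>1) / ennreal (k x \<theta>2))\<^sup>2 * ennreal (k x \<theta>3) \<partial>\<nu>) < ennreal B"
  shows
    "let fn = (\<lambda>n x. recursive_estimate \<mu> k f0 w x n);
         fbar = (\<lambda>n x. averaged_estimate \<mu> k f0 w x n);
         p = mixture \<mu> k f;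
         pn = (\<lambda>n x. mixture \<mu> k (fn n x));
         pbar = (\<lambda>n x. mixture \<mu> k (fbar n x));
         data = (\<lambda>\<omega> i. X i \<omega>)
     in
      (\<forall>d. convex_in_second \<mu> d \<and>
           (\<forall>n\<ge>1. (\<lambda>x. d f (fn n x)) \<in> borel_measurable (PiM {1..n} (\<lambda>_. borel)) \<and>
                   (\<lambda>x. d f (fbar n x)) \<in> borel_measurable (PiM {1..n} (\<lambda>_. borel))) \<longrightarrow>
           (\<forall>n\<ge>1. (\<integral>\<^sup>+\<omega>. d f (fbar n (data \<omega>)) \<partial>M) \<le> (\<integral>\<^sup>+\<omega>. d f (fn n (data \<omega>)) \<partial>M))) \<and>
      (\<forall>d. convex_in_second \<nu> d \<and>
           (\<forall>n\<ge>1. (\<lambda>x. d p (pn n x)) \<in> borel_measurable (PiM {1..n} (\<lambda>_. borel)) \<and>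
                   (\<lambda>x. d p (pbar n x)) \<in> borel_measurable (PiM {1..n} (\<lambda>_. borel))) \<longrightarrow>
           (\<forall>n\<ge>1. (\<integral>\<^sup>+\<omega>. d p (pbar n (data \<omega>)) \<partial>M) \<le> (\<integral>\<^sup>+\<omega>. d p (pn n (data \<omega>)) \<partial>M))) \<and>
      (\<forall>n\<ge>1.
        (\<integral>\<^sup>+\<omega>. kl_div \<mu> f (fbar n (data \<omega>)) \<partial>M) \<le> (\<integral>\<^sup>+\<omega>. kl_div \<mu> f (fn n (data \<omega>)) \<partial>M) \<and>
        (\<integral>\<^sup>+\<omega>. kl_div \<nu> p (pbar n (data \<omega>)) \<partial>M) \<le> (\<integral>\<^sup>+\<omega>. kl_div \<nu> p (pn n (data \<omega>)) \<partial>M) \<and>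
        (\<integral>\<^sup>+\<omega>. l1_dist \<mu> f (fbar n (data \<omega>)) \<partial>M) \<le> (\<integral>\<^sup>+\<omega>. l1_dist \<mu> f (fn n (data \<omega>)) \<partial>M) \<and>
        (\<integral>\<^sup>+\<omega>. l1_dist \<nu> p (pbar n (data \<omega>)) \<partial>M) \<le> (\<integral>\<^sup>+\<omega>. l1_dist \<nu> p (pn n (data \<omega>)) \<partial>M))"
proof -
  interpret T: sigma_finite_measure \<mu> by fact
  interpret X: sigma_finite_measure \<nu> by fact
  interpret mixture_model \<nu> \<mu> k
    by unfold_locales (use assms(1,3,5,6) A3 in auto)
  interpret prob_space M by fact
  let ?p = "mixture \<mu> k f"
  let ?r = "recursive_estimate \<mu> k f0 w"
  let ?a = "averaged_estimate \<mu> k f0 w"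
  have f: "prob_density \<mu> f"
  proof -
    have [measurable]: "f \<in> borel_measurable \<mu>"
      using assms(9) by (simp add: measurable_cong_sets[OF sets_\<mu> refl])
    have "(\<integral>\<^sup>+\<theta>. ennreal (f \<theta>) \<partial>\<mu>) = emeasure F (space F)"
      by (simp add: assms(8) emeasure_density)
    also have "\<dots> = 1" by (rule prob_space.emeasure_space_1) fact
    finally show ?thesis using assms(10) by (simp add: prob_density_def)
  qed
  have p: "prob_density \<nu> ?p" by (rule prob_density_mixture[OF f])
  note f0 = \<open>prob_density \<mu> f0\<close>

  have law: "distr M borel (X i) = density \<nu> (\<lambda>x. ennreal (?p x))" if "1 \<le> i" for i
    using distributed_distr_eq_density[OF assms(15)[OF that]] assms(1)
    by (metis distr_cong)
  have supp: "AE x in \<nu>. 0 < k x \<theta>1 \<longrightarrow> 0 < k x \<theta>2" for \<theta>1 \<theta>2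
  proof -
    obtain B :: real where
      B: "(\<integral>\<^sup>+x. (ennreal (k x \<theta>1) / ennreal (k x \<theta>2))\<^sup>2 * ennreal (k x \<theta>1) \<partial>\<nu>) < ennreal B"
      using A5 by blast
    have "(\<integral>\<^sup>+x. (ennreal (k x \<theta>1) / ennreal (k x \<theta>2))\<^sup>2 * ennreal (k x \<theta>1) \<partial>\<nu>) < \<infinity>"
      using less_trans[OF B ennreal_less_top] by simp
    then show ?thesis
      by (intro AE_support_of_ratio_bound prob_densityD(1)[OF kernel_density]) auto
  qed
  have pos: "AE \<omega> in M. \<forall>i\<in>{1..}. 0 < mixture \<mu> k f0 (X i \<omega>)"
  proof (subst AE_ball_countable, simp, intro ballI)
    fix i :: nat assume "i \<in> {1..}"
    then have D: "distributed M \<nu> (X i) (\<lambda>x. ennreal (?p x))" using assms(15) by auto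
    show "AE \<omega> in M. 0 < mixture \<mu> k f0 (X i \<omega>)"
      using AE_mixture_pos[OF supp f f0] unfolding distributed_distr_eq_density[OF D, symmetric]
      by (rule AE_distrD[OF distributed_measurable[OF D]])
  qed
  have dens: "AE \<omega> in M. \<forall>n s. s permutes {1..n} \<longrightarrow> prob_density \<mu> (?r (\<lambda>i. X (s i) \<omega>) n)"
    using pos
  proof (eventually_elim, intro allI impI)
    fix \<omega> and n :: nat and s :: "nat \<Rightarrow> nat"
    assume pos: "\<forall>i\<in>{1..}. 0 < mixture \<mu> k f0 (X i \<omega>)" and s: "s permutes {1..n}"
    have "0 < mixture \<mu> k f0 (X (s i) \<omega>)" if "i \<in> {1..n}" for i
      using permutes_in_image[OF s, of i] that pos by auto
    then show "prob_density \<mu> (?r (\<lambda>i. X (s i) \<omega>) n)"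
      using recursive_estimate_density[OF f0, of n w "\<lambda>i. X (s i) \<omega>"] assms(12) by auto
  qed
  have perms: "finite {s. s permutes {1..n}}" "{s. s permutes {1..n}} \<noteq> {}" for n :: nat
    by (auto simp: finite_permutations intro: permutes_id)

  have est: "(\<integral>\<^sup>+\<omega>. d f (?a (\<lambda>i. X i \<omega>) n) \<partial>M) \<le> (\<integral>\<^sup>+\<omega>. d f (?r (\<lambda>i. X i \<omega>) n) \<partial>M)"
    if d: "convex_in_second \<mu> d" and n: "1 \<le> n"
      and m: "(\<lambda>x. d f (?r x n)) \<in> borel_measurable (PiM {1..n} (\<lambda>_. borel))" for d n
  proof (rule expectation_le_of_permutation_average[OF assms(14) law, where I = "{1..n}"])
    show "AE \<omega> in M. d f (?a (\<lambda>i. X i \<omega>) n)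
      \<le> ennreal (1 / fact (card {1..n})) * (\<Sum>s | s permutes {1..n}. d f (?r (\<lambda>i. X (s i) \<omega>) n))"
      using dens
    proof eventually_elim
      case (elim \<omega>)
      then show ?case
        using convex_in_second_average[OF d f perms, of n "\<lambda>s. ?r (\<lambda>i. X (s i) \<omega>) n"]
        by (simp add: averaged_estimate_def card_permutations[OF refl])
    qed
    show "d f (?r (restrict x {1..n}) n) = d f (?r x n)" for x
      by (subst recursive_estimate_cong[of n "restrict x {1..n}" x]) auto
  qed (use n m in auto)

  have mix: "(\<integral>\<^sup>+\<omega>. d ?p (mixture \<mu> k (?a (\<lambda>i. X i \<omega>) n)) \<partial>M)
      \<le> (\<integral>\<^sup>+\<omega>. d ?p (mixture \<mu> k (?r (\<lambda>i. X i \<omega>) n)) \<partial>M)"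
    if d: "convex_in_second \<nu> d" and n: "1 \<le> n"
      and m: "(\<lambda>x. d ?p (mixture \<mu> k (?r x n))) \<in> borel_measurable (PiM {1..n} (\<lambda>_. borel))" for d n
  proof (rule expectation_le_of_permutation_average[OF assms(14) law, where I = "{1..n}"])
    show "AE \<omega> in M. d ?p (mixture \<mu> k (?a (\<lambda>i. X i \<omega>) n))
      \<le> ennreal (1 / fact (card {1..n})) *
        (\<Sum>s | s permutes {1..n}. d ?p (mixture \<mu> k (?r (\<lambda>i. X (s i) \<omega>) n)))"
      using dens
    proof eventually_elim
      case (elim \<omega>)
      have "mixture \<mu> k (?a (\<lambda>i. X i \<omega>) n) = (\<lambda>x. 1 / fact n *
          (\<Sum>s | s permutes {1..n}. mixture \<mu> k (?r (\<lambda>i. X (s i) \<omega>) n) x))"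
        unfolding averaged_estimate_def by (intro mixture_average) (use elim prob_densityD(4) in auto)
      then show ?case
        using convex_in_second_average[OF d p perms, of n "\<lambda>s. mixture \<mu> k (?r (\<lambda>i. X (s i) \<omega>) n)"]
          elim prob_density_mixture
        by (simp add: card_permutations[OF refl])
    qed
    show "d ?p (mixture \<mu> k (?r (restrict x {1..n}) n)) = d ?p (mixture \<mu> k (?r x n))" for x
      by (subst recursive_estimate_cong[of n "restrict x {1..n}" x]) auto
  qed (use n m in auto)

  have m_est: "(\<lambda>(x, \<theta>). ?r x n \<theta>) \<in> borel_measurable (PiM {1..n} (\<lambda>_. borel) \<Otimes>\<^sub>M \<mu>)" for n
    by (rule borel_measurable_recursive_estimate[OF prob_densityD(1)[OF f0] order_refl])
  note m_mix = borel_measurable_mixture[OF m_est]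
  note m_div = T.borel_measurable_kl_div[OF prob_densityD(1)[OF f] m_est]
    X.borel_measurable_kl_div[OF prob_densityD(1)[OF p] m_mix]
    T.borel_measurable_l1_dist[OF prob_densityD(1)[OF f] m_est]
    X.borel_measurable_l1_dist[OF prob_densityD(1)[OF p] m_mix]
  note kl_l1 = est[OF convex_in_second_kl_div _ m_div(1)] mix[OF convex_in_second_kl_div _ m_div(2)]
    est[OF convex_in_second_l1_dist _ m_div(3)] mix[OF convex_in_second_l1_dist _ m_div(4)]
  show ?thesis
    unfolding Let_def by (intro conjI allI impI; (elim conjE)?) (blast intro: est mix kl_l1)+
qed

end
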